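(* Let $X$ be a compact metric space with Borel $\sigma$-algebra $\mathcal{B}$, let $m$ be a probability measure on $(X,\mathcal{B})$, and let $\mathbf{T}=\{T_1,\dots,T_d\}$ be a finite set of measurable maps $T_i:X\to X$ (a generator set of a semigroup of maps). Then: \begin{itemize} \item[(i)] $\mathrm{Rec}(\mathbf{T})\supseteq\mathrm{Rec}_u(\mathbf{T})$, $\mathrm{Rec}_u(\mathbf{T})\subseteq\mathrm{Rec}_{wu}(\mathbf{T})\subseteq\mathrm{Rec}_w(\mathbf{T})$, and $\mathrm{Rec}_w(\mathbf{T})\supseteq\mathrm{Clos}(\mathrm{Rec}(\mathbf{T}))$. \item[(ii)] Suppose that for some non-degenerate probability distribution $\mathbf{p}=\{p_1,\dots,p_d\}$ (i.e. all $p_i>0$, $\sum_i p_i=1$) the Markov chain with transition probabilities $Q(x,A):=\sum_{i=1}^d p_i1_A(T_ix)$ satisfies $$\sum_{n\ge1} m(Q^{-n}(A)\cap A)=\infty\quad\text{for all } A\in\mathcal{B}\text{ with } m(A)>0.$$ Then $m(\mathrm{Rec}(\mathbf{T}))=1$ and $\mathrm{Rec}_w(\mathbf{T})\supseteq\mathrm{supp}(m)$. \end{itemize}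
   Context: No assumptions are made on relations between the generators, and $m$ is not assumed invariant. For indices $i_1,\dots,i_n\in\{1,\dots,d\}$ put $T_{[i_1,\dots,i_n]}:=T_{i_n}\circ\dots\circ T_{i_1}$. $N(x,A,n)$ is the number of trajectories of length $n$ starting at $x$ and ending in $A$, i.e. the number of $(i_1,\dots,i_n)\in\{1,\dots,d\}^n$ with $T_{[i_1,\dots,i_n]}x\in A$ (so $N(x,X,n)=d^n$). Put $\kappa(x,A):=\liminf_{n\to\infty}\frac{N(x,A,n)}{N(x,X,n)}$. A point $x\in X$ is: recurrent if for every open neighborhood $O_x\ni x$ there is $n\ge1$ with $N(x,O_x,n)>0$; weakly recurrent if for every open neighborhood $O_x\ni x$ there are $y\in O_x$ and $n\ge1$ with $N(y,O_x,n)>0$; uniformly recurrent if $\kappa(x,O_x)>0$ for every open neighborhood $O_x\ni x$; weakly uniformly recurrent if for every open neighborhood $O_x\ni x$ there is $y\in O_x$ with $\kappa(y,O_x)>0$. The corresponding sets are $\mathrm{Rec}(\mathbf{T})$, $\mathrm{Rec}_w(\mathbf{T})$, $\mathrm{Rec}_u(\mathbf{T})$, $\mathrm{Rec}_{wu}(\mathbf{T})$. For the Markov chain, $Q^1=Q$, $Q^{n+1}(x,A)=\int Q^n(y,A)\,Q(x,dy)$, and $Q^{-n}(A):=\{x\in X: Q^n(x,A)>0\}$ for $n\ge1$. $\mathrm{Clos}$ denotes topological closure and $\mathrm{supp}(m)$ the topological support of $m$. *)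

theory Defs
  imports "HOL-Probability.Probability"
begin

text \<open>Trajectories are indexed by words over \<open>{1..d}\<close>; \<open>fold T [i\<^sub>1, \<dots>, i\<^sub>n]\<close> is
  \<open>T i\<^sub>n \<circ> \<dots> \<circ> T i\<^sub>1\<close>.  Words are counted, so coinciding compositions count with multiplicity.\<close>

definition num_traj :: "nat \<Rightarrow> (nat \<Rightarrow> 'a \<Rightarrow> 'a) \<Rightarrow> 'a \<Rightarrow> 'a set \<Rightarrow> nat \<Rightarrow> nat"
  where "num_traj d T x A n =
    card {w. length w = n \<and> set w \<subseteq> {1..d} \<and> fold T w x \<in> A}"

definition traj_freq :: "nat \<Rightarrow> (nat \<Rightarrow> 'a \<Rightarrow> 'a) \<Rightarrow> 'a \<Rightarrow> 'a set \<Rightarrow> ereal"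
  where "traj_freq d T x A =
    liminf (\<lambda>n. ereal (real (num_traj d T x A n) / real (num_traj d T x UNIV n)))"

definition Rec :: "nat \<Rightarrow> (nat \<Rightarrow> 'a \<Rightarrow> 'a) \<Rightarrow> 'a::topological_space set"
  where "Rec d T = {x. \<forall>U. open U \<and> x \<in> U \<longrightarrow> (\<exists>n\<ge>1. num_traj d T x U n > 0)}"

definition Rec_w :: "nat \<Rightarrow> (nat \<Rightarrow> 'a \<Rightarrow> 'a) \<Rightarrow> 'a::topological_space set"
  where "Rec_w d T =
    {x. \<forall>U. open U \<and> x \<in> U \<longrightarrow> (\<exists>y\<in>U. \<exists>n\<ge>1. num_traj d T y U n > 0)}"

definition Rec_u :: "nat \<Rightarrow> (nat \<Rightarrow> 'a \<Rightarrow> 'a) \<Rightarrow> 'a::topological_space set"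
  where "Rec_u d T = {x. \<forall>U. open U \<and> x \<in> U \<longrightarrow> traj_freq d T x U > 0}"

definition Rec_wu :: "nat \<Rightarrow> (nat \<Rightarrow> 'a \<Rightarrow> 'a) \<Rightarrow> 'a::topological_space set"
  where "Rec_wu d T = {x. \<forall>U. open U \<and> x \<in> U \<longrightarrow> (\<exists>y\<in>U. traj_freq d T y U > 0)}"

definition trans_kernel ::
    "nat \<Rightarrow> (nat \<Rightarrow> real) \<Rightarrow> (nat \<Rightarrow> 'a \<Rightarrow> 'a) \<Rightarrow> 'a \<Rightarrow> 'a::topological_space measure"
  where "trans_kernel d p T x =
    measure_of UNIV (sets borel) (\<lambda>A. \<Sum>i=1..d. ennreal (p i) * indicator A (T i x))"

lemma sets_trans_kernel [simp]:
  fixes T :: "nat \<Rightarrow> 'a \<Rightarrow> 'a::topological_space"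
  shows "sets (trans_kernel d p T x) = sets borel"
  using sets.sets_measure_of_eq[of "borel :: 'a measure"] by (simp add: trans_kernel_def)

text \<open>The set function in \<open>trans_kernel\<close> is countably additive, so \<open>measure_of\<close> does not
  degenerate to the null measure.\<close>

lemma emeasure_trans_kernel:
  fixes T :: "nat \<Rightarrow> 'a \<Rightarrow> 'a::topological_space"
  assumes "A \<in> sets borel"
  shows "emeasure (trans_kernel d p T x) A = (\<Sum>i=1..d. ennreal (p i) * indicator A (T i x))"
proof -
  let ?f = "\<lambda>A::'a set. \<Sum>i=1..d. ennreal (p i) * indicator A (T i x)"
  have "countably_additive (sets borel) ?f"
  proof (rule countably_additiveI)
    fix B :: "nat \<Rightarrow> 'a set" assume B: "disjoint_family B"
    have "(\<Sum>j. ?f (B j)) = (\<Sum>i=1..d. \<Sum>j. ennreal (p i) * indicator (B j) (T i x))"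
      by (intro suminf_sum) auto
    also have "\<dots> = ?f (\<Union>j. B j)"
      by (simp add: suminf_indicator[OF B])
    finally show "(\<Sum>j. ?f (B j)) = ?f (\<Union>j. B j)" .
  qed
  then have "emeasure (measure_of (space borel) (sets borel) ?f) A = ?f A"
    using assms by (intro emeasure_measure_of_sigma sets.sigma_algebra_axioms)
      (auto simp: positive_def)
  then show ?thesis
    by (simp add: trans_kernel_def)
qed

fun kernel_pow :: "('a \<Rightarrow> 'a measure) \<Rightarrow> nat \<Rightarrow> 'a \<Rightarrow> 'a set \<Rightarrow> ennreal"
  where
    "kernel_pow Q 0 x A = indicator A x"
  | "kernel_pow Q (Suc 0) x A = emeasure (Q x) A"
  | "kernel_pow Q (Suc (Suc n)) x A = (\<integral>\<^sup>+ y. kernel_pow Q (Suc n) y A \<partial>Q x)"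

definition kernel_preimage :: "('a \<Rightarrow> 'a measure) \<Rightarrow> nat \<Rightarrow> 'a set \<Rightarrow> 'a set"
  where "kernel_preimage Q n A = {x. kernel_pow Q n x A > 0}"

definition topological_support :: "'a::topological_space measure \<Rightarrow> 'a set"
  where "topological_support m = {x. \<forall>U. open U \<and> x \<in> U \<longrightarrow> emeasure m U > 0}"

end

theory Submission
  imports Defs
begin

text \<open>Part (i) is formal: a positive lower frequency of visits forces at least one visit, and an open
  neighbourhood of a limit of recurrent points contains a recurrent point, which returns to it.

  Part (ii) is Poincare's argument with \<^emph>\<open>conservativity\<close>, the divergence of the return series, in
  place of invariance.  For a Borel set \<open>U\<close> let \<open>W\<close> be the set of points of \<open>U\<close> that no nonempty word
  sends back into \<open>U\<close>.  A transition of positive probability is realised by a word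
  (\<open>kernel_pow_pos_imp_num_traj_pos\<close>), and \<open>W \<subseteq> U\<close>, so \<open>Q\<^sup>-\<^sup>n(W) \<inter> W\<close> is empty for every \<open>n \<ge> 1\<close>.
  The return series of \<open>W\<close> is then zero rather than infinite, which forces \<open>W\<close> to be null
  (\<open>never_returning_null\<close>).  A compact metric space has a countable basis,
  and a point is recurrent unless it never returns to some basic set that contains it.  Hence the complement of \<open>Rec\<close> is a countable union of null sets
  (\<open>UNIV_minus_Rec_eq\<close>).  The statement on the support follows because the closure of a set of full
  measure contains the support.\<close>

section \<open>Trajectories and measurability\<close>

lemma num_traj_pos_iff:
  "num_traj d T x A n > 0 \<longleftrightarrow> (\<exists>w. length w = n \<and> set w \<subseteq> {1..d} \<and> fold T w x \<in> A)"
proof -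
  have "finite {w. length w = n \<and> set w \<subseteq> {1..d} \<and> fold T w x \<in> A}"
    by (rule finite_subset[OF _ finite_lists_length_eq[of "{1..d}" n]]) auto
  then show ?thesis
    unfolding num_traj_def card_gt_0_iff by blast
qed

lemma num_traj_pos_mono:
  assumes "num_traj d T x A n > 0" "A \<subseteq> B"
  shows "num_traj d T x B n > 0"
proof -
  obtain w where "length w = n" "set w \<subseteq> {1..d}" "fold T w x \<in> A"
    using assms(1) unfolding num_traj_pos_iff by (elim exE conjE)
  then show ?thesis
    using assms(2) unfolding num_traj_pos_iff by (intro exI[of _ w]) auto
qed

lemma num_traj_Suc_pos:
  assumes "i \<in> {1..d}" "num_traj d T (T i x) A n > 0"
  shows "num_traj d T x A (Suc n) > 0"
proof -
  obtain w where "length w = n" "set w \<subseteq> {1..d}" "fold T w (T i x) \<in> A"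
    using assms(2) unfolding num_traj_pos_iff by (elim exE conjE)
  then show ?thesis
    using assms(1) unfolding num_traj_pos_iff by (intro exI[of _ "i # w"]) simp
qed

lemma measurable_fold:
  fixes T :: "'i \<Rightarrow> 'a \<Rightarrow> 'a"
  assumes "\<And>i. i \<in> set w \<Longrightarrow> T i \<in> measurable M M"
  shows "fold T w \<in> measurable M M"
  using assms
proof (induction w)
  case Nil
  then show ?case by (simp add: id_def)
next
  case (Cons i w)
  have "fold T w \<circ> T i \<in> measurable M M"
    using Cons by (intro measurable_comp) auto
  then show ?case by (simp add: comp_def)
qed

lemma sets_num_traj_pos:
  fixes T :: "nat \<Rightarrow> 'a \<Rightarrow> 'a::topological_space"
  assumes T: "\<And>i. i \<in> {1..d} \<Longrightarrow> T i \<in> measurable borel borel"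
    and A: "A \<in> sets borel"
  shows "{x. num_traj d T x A n > 0} \<in> sets borel"
proof -
  have "fold T w -` A \<in> sets borel" if "set w \<subseteq> {1..d}" for w
  proof -
    have "fold T w \<in> measurable borel borel"
      using T that by (intro measurable_fold) blast
    then show ?thesis
      using measurable_sets[of "fold T w" borel borel A] A by simp
  qed
  moreover have "{x. num_traj d T x A n > 0} =
      (\<Union>w\<in>{w. set w \<subseteq> {1..d} \<and> length w = n}. fold T w -` A)"
    unfolding num_traj_pos_iff by blast
  moreover have "finite {w. set w \<subseteq> {1..d} \<and> length w = n}"
    by (rule finite_lists_length_eq) simp
  ultimately show ?thesis
    by simp
qed

section \<open>Inclusions between the recurrence sets\<close>

text \<open>The lower limit only says that visits occur at all large times; this yields a visit at some
  time \<open>n \<ge> 1\<close>, as both notions of recurrence require.\<close>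

lemma traj_freq_pos_imp_visit:
  assumes "traj_freq d T x A > 0"
  shows "\<exists>n\<ge>1. num_traj d T x A n > 0"
proof -
  have "\<forall>\<^sub>F n in sequentially.
      0 < ereal (real (num_traj d T x A n) / real (num_traj d T x UNIV n))"
    using assms unfolding traj_freq_def by (rule less_LiminfD)
  then obtain N where "\<And>n. n \<ge> N \<Longrightarrow>
      0 < ereal (real (num_traj d T x A n) / real (num_traj d T x UNIV n))"
    unfolding eventually_sequentially by blast
  from this[of "max N 1"] have "num_traj d T x A (max N 1) > 0"
    by (auto simp: zero_less_divide_iff)
  then show ?thesis
    by (intro exI[of _ "max N 1"]) simp
qed

lemma Rec_u_subset_Rec: "Rec_u d T \<subseteq> Rec d T"
proof
  fix x assume "x \<in> Rec_u d T"
  then have "traj_freq d T x U > 0" if "open U" "x \<in> U" for U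
    using that by (simp add: Rec_u_def)
  then show "x \<in> Rec d T"
    by (simp add: Rec_def traj_freq_pos_imp_visit del: One_nat_def)
qed

lemma Rec_u_subset_Rec_wu: "Rec_u d T \<subseteq> Rec_wu d T"
  unfolding Rec_u_def Rec_wu_def by blast

lemma Rec_wu_subset_Rec_w: "Rec_wu d T \<subseteq> Rec_w d T"
proof
  fix x assume x: "x \<in> Rec_wu d T"
  have "\<exists>y\<in>U. \<exists>n\<ge>1. num_traj d T y U n > 0" if "open U" "x \<in> U" for U
  proof -
    have "\<exists>y\<in>U. traj_freq d T y U > 0"
      using x that by (simp add: Rec_wu_def)
    then show ?thesis
      by (elim bexE, intro bexI traj_freq_pos_imp_visit)
  qed
  then show "x \<in> Rec_w d T"
    by (simp add: Rec_w_def)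
qed

lemma closure_Rec_subset_Rec_w: "closure (Rec d T) \<subseteq> Rec_w d T"
proof
  fix x assume x: "x \<in> closure (Rec d T)"
  have "\<exists>y\<in>U. \<exists>n\<ge>1. num_traj d T y U n > 0" if U: "open U" "x \<in> U" for U
  proof -
    from x U obtain y where "y \<in> Rec d T" "y \<in> U"
      using open_Int_closure_eq_empty[of U "Rec d T"] by blast
    then show ?thesis
      using U unfolding Rec_def by blast
  qed
  then show "x \<in> Rec_w d T"
    unfolding Rec_w_def by blast
qed

section \<open>Points that never return\<close>

text \<open>By induction on \<open>n\<close>: from \<open>x\<close> the chain moves only to the points \<open>T i x\<close>, so if no word
  leads from \<open>x\<close> to \<open>A\<close>, then almost every successor of \<open>x\<close> has the same defect for words shorter
  by one letter, and the integral defining \<open>Q\<^sup>n(x, A)\<close> vanishes.\<close>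

lemma kernel_pow_pos_imp_num_traj_pos:
  fixes T :: "nat \<Rightarrow> 'a \<Rightarrow> 'a::topological_space"
  assumes T: "\<And>i. i \<in> {1..d} \<Longrightarrow> T i \<in> measurable borel borel"
    and A: "A \<in> sets borel"
    and pos: "kernel_pow (trans_kernel d p T) n x A > 0"
  shows "num_traj d T x A n > 0"
proof -
  let ?Q = "trans_kernel d p T"
  \<comment> \<open>A transition to a Borel set has probability zero if no generator makes it.\<close>
  have null: "emeasure (?Q x) B = 0" if "B \<in> sets borel" "\<And>i. i \<in> {1..d} \<Longrightarrow> T i x \<notin> B" for x B
    using that by (simp add: emeasure_trans_kernel)
  have "num_traj d T x A n = 0 \<Longrightarrow> kernel_pow ?Q n x A = 0" for x
  proof (induction n arbitrary: x rule: induct_nat_012)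
    case 0
    have "x \<notin> A"
      using 0 num_traj_pos_iff[of d T x A 0] by auto
    then show ?case by simp
  next
    case 1
    have "T i x \<notin> A" if i: "i \<in> {1..d}" for i
    proof
      assume "T i x \<in> A"
      then have "num_traj d T (T i x) A 0 > 0"
        by (simp add: num_traj_pos_iff)
      from num_traj_Suc_pos[OF i this] 1 show False by simp
    qed
    from null[OF A this] show ?case
      by simp
  next
    case (ge2 n)
    let ?S = "{y. num_traj d T y A (Suc n) > 0}"
    have "?S \<in> sets borel"
      by (rule sets_num_traj_pos[OF T A])
    moreover have "T i x \<notin> ?S" if "i \<in> {1..d}" for i
      using num_traj_Suc_pos[OF that, of T x A "Suc n"] ge2.prems by auto
    ultimately have "?S \<in> null_sets (?Q x)"
      by (intro null_setsI null) auto
    then have "AE y in ?Q x. y \<notin> ?S"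
      by (rule AE_not_in)
    then have "AE y in ?Q x. kernel_pow ?Q (Suc n) y A = 0"
      by eventually_elim (auto intro: ge2.IH(2))
    then have "(\<integral>\<^sup>+ y. kernel_pow ?Q (Suc n) y A \<partial>?Q x) = (\<integral>\<^sup>+ y. 0 \<partial>?Q x)"
      by (rule nn_integral_cong_AE)
    then show ?case by simp
  qed
  then show ?thesis
    using pos by (metis gr0I less_irrefl)
qed

definition never_returning :: "nat \<Rightarrow> (nat \<Rightarrow> 'a \<Rightarrow> 'a) \<Rightarrow> 'a set \<Rightarrow> 'a set"
  where "never_returning d T U = {x\<in>U. \<forall>n\<ge>1. num_traj d T x U n = 0}"

lemma sets_never_returning:
  fixes T :: "nat \<Rightarrow> 'a \<Rightarrow> 'a::topological_space"
  assumes T: "\<And>i. i \<in> {1..d} \<Longrightarrow> T i \<in> measurable borel borel"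
    and U: "U \<in> sets borel"
  shows "never_returning d T U \<in> sets borel"
proof -
  have "never_returning d T U = U - (\<Union>n\<in>{1..}. {x. num_traj d T x U n > 0})"
    by (simp add: never_returning_def set_eq_iff Ball_def)
  also have "\<dots> \<in> sets borel"
    using U sets_num_traj_pos[OF T U] by (intro sets.Diff sets.countable_UN') auto
  finally show ?thesis .
qed

text \<open>A return to the set of never returning points would in particular be a return to \<open>U\<close>; so all
  terms of the return series of this set vanish.\<close>

lemma never_returning_null:
  fixes T :: "nat \<Rightarrow> 'a \<Rightarrow> 'a::topological_space"
  assumes T: "\<And>i. i \<in> {1..d} \<Longrightarrow> T i \<in> measurable borel borel"
    and sets_m: "sets m = sets borel"
    and conservative: "\<And>A. A \<in> sets borel \<Longrightarrow> emeasure m A > 0 \<Longrightarrow>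
      (\<Sum>n. emeasure m (kernel_preimage (trans_kernel d p T) (Suc n) A \<inter> A)) = \<infinity>"
    and U: "U \<in> sets borel"
  shows "never_returning d T U \<in> null_sets m"
proof (rule ccontr)
  let ?W = "never_returning d T U"
  have W: "?W \<in> sets borel"
    by (rule sets_never_returning[OF T U])
  have "kernel_preimage (trans_kernel d p T) (Suc n) ?W \<inter> ?W = {}" for n
  proof (rule ccontr)
    assume "kernel_preimage (trans_kernel d p T) (Suc n) ?W \<inter> ?W \<noteq> {}"
    then obtain x where x: "x \<in> ?W" "kernel_pow (trans_kernel d p T) (Suc n) x ?W > 0"
      unfolding kernel_preimage_def by blast
    have "num_traj d T x ?W (Suc n) > 0"
      using kernel_pow_pos_imp_num_traj_pos[OF T W x(2)] .
    then have "num_traj d T x U (Suc n) > 0"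
      by (rule num_traj_pos_mono) (auto simp: never_returning_def)
    with x(1) show False
      unfolding never_returning_def by auto
  qed
  then have series: "(\<Sum>n. emeasure m (kernel_preimage (trans_kernel d p T) (Suc n) ?W \<inter> ?W)) = 0"
    by simp
  assume "?W \<notin> null_sets m"
  then have "emeasure m ?W > 0"
    using W sets_m by (auto simp: null_sets_def zero_less_iff_neq_zero)
  from conservative[OF W this] series show False
    by simp
qed

section \<open>Almost every point is recurrent\<close>

text \<open>The basis consists of finite covers by balls of radius \<open>1/n\<close>, one for each \<open>n\<close>.\<close>

lemma compact_UNIV_countable_basis:
  assumes "compact (UNIV :: 'a::metric_space set)"
  obtains \<B> :: "'a::metric_space set set" where "countable \<B>" "topological_basis \<B>"
proof -
  have "\<forall>e>0. \<exists>k::'a set. finite k \<and> k \<subseteq> UNIV \<and> UNIV \<subseteq> (\<Union>x\<in>k. ball x e)"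
    using assms by (intro seq_compact_imp_totally_bounded compact_imp_seq_compact)
  then have "\<forall>n::nat. \<exists>k::'a set. finite k \<and> UNIV \<subseteq> (\<Union>x\<in>k. ball x (inverse (Suc n)))"
    by simp
  then obtain K :: "nat \<Rightarrow> 'a set"
    where finK: "\<And>n. finite (K n)"
      and cover: "\<And>n. UNIV \<subseteq> (\<Union>x\<in>K n. ball x (inverse (Suc n)))"
    by metis
  let ?B = "\<Union>n. (\<lambda>x. ball x (inverse (Suc n))) ` K n"
  have "countable ?B"
    using finK by (intro countable_UN countable_image) (auto intro: countable_finite)
  moreover have "topological_basis ?B"
  proof (rule topological_basisI)
    fix U and x :: 'a assume "open U" "x \<in> U"
    then obtain e where e: "e > 0" "ball x e \<subseteq> U"
      by (auto simp: open_contains_ball)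
    \<comment> \<open>Half of \<open>e\<close>: the ball that contains \<open>x\<close> is centred elsewhere.\<close>
    obtain n where n: "inverse (real (Suc n)) < e / 2"
      using reals_Archimedean[of "e / 2"] e(1) by auto
    obtain y where y: "y \<in> K n" "x \<in> ball y (inverse (Suc n))"
      using cover[of n] by blast
    have "ball y (inverse (Suc n)) \<subseteq> ball x e"
    proof
      fix z assume "z \<in> ball y (inverse (Suc n))"
      then show "z \<in> ball x e"
        using y(2) n dist_triangle[of x z y] by (simp add: dist_commute)
    qed
    then show "\<exists>B'\<in>?B. x \<in> B' \<and> B' \<subseteq> U"
      using y e(2) by blast
  qed auto
  ultimately show thesis
    by (rule that)
qed

text \<open>The equality, not just one inclusion, is what makes \<open>Rec\<close> a Borel set.\<close>

lemma UNIV_minus_Rec_eq: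
  assumes basis: "topological_basis \<B>"
  shows "UNIV - Rec d T = (\<Union>U\<in>\<B>. never_returning d T U)"
proof (intro equalityI subsetI)
  fix x assume "x \<in> UNIV - Rec d T"
  then obtain V where V: "open V" "x \<in> V" "\<not> (\<exists>n\<ge>1. num_traj d T x V n > 0)"
    by (auto simp: Rec_def)
  obtain U where U: "U \<in> \<B>" "x \<in> U" "U \<subseteq> V"
    by (rule topological_basisE[OF basis V(1,2)])
  have "num_traj d T x U n = 0" if "n \<ge> 1" for n
  proof (rule ccontr)
    assume "num_traj d T x U n \<noteq> 0"
    then have "num_traj d T x V n > 0"
      by (intro num_traj_pos_mono[OF _ U(3)]) simp
    with V(3) that show False by blast
  qed
  with U(2) have "x \<in> never_returning d T U"
    by (simp add: never_returning_def)
  with U(1) show "x \<in> (\<Union>U\<in>\<B>. never_returning d T U)"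
    by (rule UN_I)
next
  fix x assume "x \<in> (\<Union>U\<in>\<B>. never_returning d T U)"
  then obtain U where U: "U \<in> \<B>" "x \<in> never_returning d T U"
    by (rule UN_E)
  have "open U"
    using basis U(1) by (rule topological_basis_open)
  moreover have "x \<in> U" "\<not> (\<exists>n\<ge>1. num_traj d T x U n > 0)"
    using U(2) by (simp_all add: never_returning_def)
  ultimately have "x \<notin> Rec d T"
    unfolding Rec_def by blast
  then show "x \<in> UNIV - Rec d T"
    by simp
qed

lemma emeasure_Rec_eq_1:
  fixes T :: "nat \<Rightarrow> 'a \<Rightarrow> 'a::topological_space" and \<B> :: "'a set set"
  assumes m: "prob_space m" "sets m = sets borel"
    and T: "\<And>i. i \<in> {1..d} \<Longrightarrow> T i \<in> measurable borel borel"
    and basis: "countable \<B>" "topological_basis \<B>"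
    and conservative: "\<And>A. A \<in> sets borel \<Longrightarrow> emeasure m A > 0 \<Longrightarrow>
      (\<Sum>n. emeasure m (kernel_preimage (trans_kernel d p T) (Suc n) A \<inter> A)) = \<infinity>"
  shows "Rec d T \<in> sets borel" and "emeasure m (Rec d T) = 1"
proof -
  interpret prob_space m by fact
  have space: "space m = UNIV"
    using sets_eq_imp_space_eq[OF m(2)] by simp
  have "(\<Union>U\<in>\<B>. never_returning d T U) \<in> null_sets m"
    using basis by (intro null_sets_UN' never_returning_null[OF T m(2) conservative])
      (auto dest: topological_basis_open)
  then have null: "UNIV - Rec d T \<in> null_sets m"
    by (simp add: UNIV_minus_Rec_eq[OF basis(2)])
  have Rec_eq: "Rec d T = space m - (UNIV - Rec d T)"
    by (auto simp: space)
  have "space m - (UNIV - Rec d T) \<in> sets m"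
    using null by blast
  then show "Rec d T \<in> sets borel"
    using m(2) Rec_eq by simp
  show "emeasure m (Rec d T) = 1"
    by (subst Rec_eq) (use null in \<open>simp only: emeasure_Diff_null_set sets.top emeasure_space_1\<close>)
qed

lemma topological_support_subset_closure:
  assumes m: "prob_space m" "sets m = sets borel"
    and A: "A \<in> sets borel" "emeasure m A = 1"
  shows "topological_support m \<subseteq> closure A"
proof (rule ccontr)
  interpret prob_space m by fact
  have space: "space m = UNIV"
    using sets_eq_imp_space_eq[OF m(2)] by simp
  assume "\<not> topological_support m \<subseteq> closure A"
  then obtain x where "x \<in> topological_support m" "x \<in> - closure A"
    by blast
  moreover have "open (- closure A)"
    by (intro open_Compl closed_closure)
  ultimately have "emeasure m (- closure A) > 0"
    unfolding topological_support_def by simp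
  moreover have "emeasure m (- closure A) \<le> emeasure m (space m - A)"
  proof (rule emeasure_mono)
    show "- closure A \<subseteq> space m - A"
      using closure_subset[of A] unfolding space by blast
    show "space m - A \<in> sets m"
      using A(1) m(2) by blast
  qed
  moreover have "emeasure m (space m - A) = 0"
    using A m(2) by (simp add: emeasure_compl emeasure_space_1)
  ultimately show False
    by simp
qed

theorem corollary4:
  fixes m :: "'a::metric_space measure"
    and d :: nat
    and T :: "nat \<Rightarrow> 'a \<Rightarrow> 'a"
  assumes "compact (UNIV :: 'a set)"
    and "prob_space m"
    and "sets m = sets borel"
    and "d \<ge> 1"
    and "\<And>i. i \<in> {1..d} \<Longrightarrow> T i \<in> measurable borel borel"
  shows "(Rec_u d T \<subseteq> Rec d T \<and> Rec_u d T \<subseteq> Rec_wu d T \<and> Rec_wu d T \<subseteq> Rec_w d T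
        \<and> closure (Rec d T) \<subseteq> Rec_w d T)
    \<and> ((\<exists>p :: nat \<Rightarrow> real. (\<forall>i\<in>{1..d}. p i > 0) \<and> (\<Sum>i=1..d. p i) = 1
          \<and> (\<forall>A\<in>sets borel. emeasure m A > 0 \<longrightarrow>
               (\<Sum>n. emeasure m (kernel_preimage (trans_kernel d p T) (Suc n) A \<inter> A)) = \<infinity>))
        \<longrightarrow> emeasure m (Rec d T) = 1 \<and> topological_support m \<subseteq> Rec_w d T)"
proof (intro conjI impI)
  show "Rec_u d T \<subseteq> Rec d T" "Rec_u d T \<subseteq> Rec_wu d T" "Rec_wu d T \<subseteq> Rec_w d T"
    "closure (Rec d T) \<subseteq> Rec_w d T"
    by (rule Rec_u_subset_Rec Rec_u_subset_Rec_wu Rec_wu_subset_Rec_w closure_Rec_subset_Rec_w)+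
next
  assume "\<exists>p :: nat \<Rightarrow> real. (\<forall>i\<in>{1..d}. p i > 0) \<and> (\<Sum>i=1..d. p i) = 1
          \<and> (\<forall>A\<in>sets borel. emeasure m A > 0 \<longrightarrow>
               (\<Sum>n. emeasure m (kernel_preimage (trans_kernel d p T) (Suc n) A \<inter> A)) = \<infinity>)"
  then obtain p where "\<forall>A\<in>sets borel. emeasure m A > 0 \<longrightarrow>
      (\<Sum>n. emeasure m (kernel_preimage (trans_kernel d p T) (Suc n) A \<inter> A)) = \<infinity>"
    by (elim exE conjE)
  then have conservative: "(\<Sum>n. emeasure m (kernel_preimage (trans_kernel d p T) (Suc n) A \<inter> A)) = \<infinity>"
    if "A \<in> sets borel" "emeasure m A > 0" for A
    using that by simp
  obtain \<B> :: "'a set set" where basis: "countable \<B>" "topological_basis \<B>"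
    using compact_UNIV_countable_basis[OF assms(1)] .
  note Rec = emeasure_Rec_eq_1[OF assms(2,3,5) basis conservative]
  show "emeasure m (Rec d T) = 1"
    by (rule Rec(2))
  show "topological_support m \<subseteq> Rec_w d T"
    using topological_support_subset_closure[OF assms(2,3) Rec] closure_Rec_subset_Rec_w
    by (rule order_trans)
qed

end
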